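(* Let $\mathcal{M}$ be either of the closure operators $\mathcal{A}$ (aggregation closure) or $\mathcal{C}$ (Chvátal–Gomory closure). For every covering polyhedron with bounds $Q=\{x\in\mathbb{R}^n_+\mid Ax\ge b,\ x\le u\}$ (upper bounds possibly infinite), the 1-row closure $1\mathcal{M}(Q)$ is a $2$-approximation of $\mathcal{M}(Q)$. Moreover, this bound is tight: for every $\varepsilon>0$ there is a covering polyhedron with bounds $Q$ (upper bounds possibly infinite) such that $1\mathcal{M}(Q)$ is not a $(2-\varepsilon)$-approximation of $\mathcal{M}(Q)$.
   Context: A covering polyhedron with bounds is $Q=\{x\in\mathbb{R}^n_+\mid Ax\ge b,\ x\le u\}$ with $A\in\mathbb{Q}^{m\times n}$, $b\in\mathbb{Q}^m$ entrywise non-negative, and each component of $u$ either a non-negative integer or $+\infty$; if all $u_j=+\infty$ it is called a covering polyhedron. $A^i$ denotes the $i$-th row of $A$. The CG closure is $\mathcal{C}(Q)=\{x\in Q\mid a^\top x\ge\lceil\beta\rceil\text{ for all }a\in\mathbb{Z}^n,\beta\in\mathbb{R}\text{ with }a^\top x\ge\beta\text{ valid for }Q\}$. The aggregation closure (with respect to the given description) is $\mathcal{A}(Q)=\bigcap_{\lambda\in\mathbb{R}^m_+}\operatorname{conv}(\{x\in\mathbb{Z}^n_+\mid\lambda^\top Ax\ge\lambda^\top b,\ x\le u\})$. The 1-row closures are $1\mathcal{C}(Q)=\bigcap_{i=1}^m\mathcal{C}(\{x\in\mathbb{R}^n_+\mid A^ix\ge b_i,\ x\le u\})$ and $1\mathcal{A}(Q)=\bigcap_{i=1}^m\mathcal{A}(\{x\in\mathbb{R}^n_+\mid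 A^ix\ge b_i,\ x\le u\})$. For $U\supseteq V$ of this covering type, $U$ is an $\alpha$-approximation of $V$ if $\min\{c^\top x\mid x\in U\}\ge\frac1\alpha\min\{c^\top x\mid x\in V\}$ for all $c\in\mathbb{R}^n_+$ (minima are read as infima, with value $+\infty$ over the empty set). *)

theory Defs
  imports "Jordan_Normal_Form.Matrix" "HOL-Library.Extended_Real"
begin

text \<open>
  The dimensions \<open>m\<close> and \<open>n\<close> must be quantified over inside the statement, so \<open>\<real>\<^sup>n\<close> is
  \<open>carrier_vec n\<close>. The order on vectors is componentwise. Upper bounds, being non-negative
  integers or \<open>+\<infinity>\<close>, are extended naturals. There is at least one row: with \<open>m = 0\<close> the 1-row
  closure would be an intersection of an empty family.
\<close>

definition covering_data :: "nat \<Rightarrow> nat \<Rightarrow> real mat \<Rightarrow> real vec \<Rightarrow> enat vec \<Rightarrow> bool" where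
  "covering_data m n A b u \<longleftrightarrow>
     0 < m \<and> A \<in> carrier_mat m n \<and> b \<in> carrier_vec m \<and> u \<in> carrier_vec n \<and>
     (\<forall>i<m. \<forall>j<n. A $$ (i, j) \<in> \<rat> \<and> 0 \<le> A $$ (i, j)) \<and>
     (\<forall>i<m. b $ i \<in> \<rat> \<and> 0 \<le> b $ i)"

definition below_bounds :: "real vec \<Rightarrow> enat vec \<Rightarrow> bool" where
  "below_bounds x u \<longleftrightarrow> (\<forall>j<dim_vec u. ereal (x $ j) \<le> ereal_of_enat (u $ j))"

definition covering_polyhedron :: "real mat \<Rightarrow> real vec \<Rightarrow> enat vec \<Rightarrow> real vec set" where
  "covering_polyhedron A b u =
     {x \<in> carrier_vec (dim_col A). 0\<^sub>v (dim_col A) \<le> x \<and> b \<le> A *\<^sub>v x \<and> below_bounds x u}"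

text \<open>The type \<open>real vec\<close> has no \<open>real_vector\<close> instance, hence no library convex hull.\<close>

definition conv_hull :: "nat \<Rightarrow> real vec set \<Rightarrow> real vec set" where
  "conv_hull n S =
     {vec n (\<lambda>j. \<Sum>v\<in>F. w v * v $ j) | F w.
        finite F \<and> F \<subseteq> S \<and> (\<forall>v\<in>F. 0 \<le> w v) \<and> (\<Sum>v\<in>F. w v) = 1}"

definition CG_closure :: "nat \<Rightarrow> real vec set \<Rightarrow> real vec set" where
  "CG_closure n Q =
     {x \<in> Q. \<forall>a \<in> carrier_vec n. \<forall>\<beta>::real.
        (\<forall>j<n. a $ j \<in> \<int>) \<and> (\<forall>y\<in>Q. \<beta> \<le> a \<bullet> y) \<longrightarrow> of_int \<lceil>\<beta>\<rceil> \<le> a \<bullet> x}"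

definition chvatal_gomory :: "real mat \<Rightarrow> real vec \<Rightarrow> enat vec \<Rightarrow> real vec set" where
  "chvatal_gomory A b u = CG_closure (dim_col A) (covering_polyhedron A b u)"

text \<open>Unlike the Chvatal-Gomory closure, the aggregation closure depends on the description
  \<open>(A, b, u)\<close> and not only on the polyhedron.\<close>

definition aggregation :: "real mat \<Rightarrow> real vec \<Rightarrow> enat vec \<Rightarrow> real vec set" where
  "aggregation A b u =
     (\<Inter>l \<in> {l \<in> carrier_vec (dim_row A). 0\<^sub>v (dim_row A) \<le> l}.
        conv_hull (dim_col A)
          {x \<in> carrier_vec (dim_col A).
             (\<forall>j<dim_col A. x $ j \<in> \<nat>) \<and> l \<bullet> b \<le> l \<bullet> (A *\<^sub>v x) \<and> below_bounds x u})"

definition one_row ::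
    "(real mat \<Rightarrow> real vec \<Rightarrow> enat vec \<Rightarrow> real vec set) \<Rightarrow>
     real mat \<Rightarrow> real vec \<Rightarrow> enat vec \<Rightarrow> real vec set" where
  "one_row M A b u =
     (\<Inter>i<dim_row A. M (mat_of_rows (dim_col A) [row A i]) (vec_of_list [b $ i]) u)"

text \<open>The infima live in \<open>ereal\<close>, where the infimum over the empty set is \<open>+\<infinity>\<close>. The factor
  \<open>1/\<alpha>\<close> only makes sense for \<open>\<alpha> > 0\<close> (note that \<open>1/0 = 0\<close> in HOL).\<close>

definition approximation_of :: "nat \<Rightarrow> real \<Rightarrow> real vec set \<Rightarrow> real vec set \<Rightarrow> bool" where
  "approximation_of n \<alpha> U V \<longleftrightarrow>
     0 < \<alpha> \<and>
     (\<forall>c \<in> carrier_vec n. 0\<^sub>v n \<le> c \<longrightarrow>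
        ereal (1 / \<alpha>) * (INF x\<in>V. ereal (c \<bullet> x)) \<le> (INF x\<in>U. ereal (c \<bullet> x)))"

end

theory Submission
  imports Defs
begin

text \<open>
  Given \<open>x\<close> in the 1-row closure, move the coordinates with \<open>2x\<^sub>j > u\<^sub>j\<close> to their bound and double
  all others. The resulting point \<open>y\<close> satisfies \<open>c\<^sup>T y \<le> 2 c\<^sup>T x\<close> for \<open>c \<ge> 0\<close>, and it lies in the
  full closure. For the aggregation closure, \<open>x\<close> satisfies the knapsack cover inequalities of each
  row; after doubling, every aggregated residual knapsack holds with right-hand side \<open>2\<rho>\<close> and
  coefficients at most \<open>\<rho>\<close>, so \<open>y\<close> can be rounded to a convex combination of integer points
  satisfying it with \<open>\<rho>\<close>. For the Chvatal-Gomory closure, \<open>2\<beta> \<ge> \<lceil>\<beta>\<rceil>\<close> settles all residual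
  cuts except those with \<open>0 < \<beta> < 1\<close>, and these follow from a cut of a single row.
\<close>

section \<open>Convex hulls and rounding\<close>

lemma conv_hull_mono: "S \<subseteq> S' \<Longrightarrow> conv_hull n S \<subseteq> conv_hull n S'"
  unfolding conv_hull_def by blast

text \<open>The definition puts weights on a set of points, so for an indexed family with
  repetitions the weights of coinciding members are added up over each fibre of
  \<open>f\<close>.\<close>

lemma conv_hull_combination:
  assumes "finite I" "\<And>k. k \<in> I \<Longrightarrow> f k \<in> S" "\<And>k. k \<in> I \<Longrightarrow> 0 \<le> w k" "(\<Sum>k\<in>I. w k) = 1"
  shows "vec n (\<lambda>j. \<Sum>k\<in>I. w k * f k $ j) \<in> conv_hull n S"
proof -
  define W where "W v = (\<Sum>k | k \<in> I \<and> f k = v. w k)" for v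
  have "(\<Sum>v\<in>f ` I. W v) = 1"
    unfolding W_def using sum.image_gen[OF assms(1), of w f] assms(4) by simp
  moreover have "(\<Sum>v\<in>f ` I. W v * v $ j) = (\<Sum>k\<in>I. w k * f k $ j)" for j
    unfolding W_def sum_distrib_right sum.image_gen[OF assms(1), of "\<lambda>k. w k * f k $ j" f]
    by (intro sum.cong) auto
  moreover have "\<forall>v\<in>f ` I. 0 \<le> W v"
    unfolding W_def using assms(3) by (auto intro: sum_nonneg)
  ultimately show ?thesis
    unfolding conv_hull_def using assms(1,2)
    by (intro CollectI exI[of _ "f ` I"] exI[of _ W]) auto
qed

lemma conv_hull_base:
  assumes "x \<in> S" "x \<in> carrier_vec n"
  shows "x \<in> conv_hull n S"
proof -
  have "x = vec n (\<lambda>j. \<Sum>k\<in>{0::nat}. 1 * x $ j)"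
    using assms(2) by (intro eq_vecI) auto
  then show ?thesis
    using conv_hull_combination[of "{0::nat}" "\<lambda>_. x" S "\<lambda>_. 1" n] assms(1) by simp
qed

lemma conv_hull_convex:
  assumes "p \<in> conv_hull n S" "q \<in> conv_hull n S" "0 \<le> t" "t \<le> 1"
  shows "vec n (\<lambda>j. (1 - t) * p $ j + t * q $ j) \<in> conv_hull n S"
proof -
  from assms(1) obtain F w where F: "finite F" "F \<subseteq> S" "\<forall>v\<in>F. 0 \<le> w v" "(\<Sum>v\<in>F. w v) = 1"
    and p: "p = vec n (\<lambda>j. \<Sum>v\<in>F. w v * v $ j)" unfolding conv_hull_def by auto
  from assms(2) obtain G w' where G: "finite G" "G \<subseteq> S" "\<forall>v\<in>G. 0 \<le> w' v" "(\<Sum>v\<in>G. w' v) = 1"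
    and q: "q = vec n (\<lambda>j. \<Sum>v\<in>G. w' v * v $ j)" unfolding conv_hull_def by auto
  \<comment> \<open>The disjoint sum keeps a point common to \<open>F\<close> and \<open>G\<close>
    as two separate members, so no weights have to be merged here.\<close>
  define f where "f = case_sum (\<lambda>v. v) (\<lambda>v. v :: real vec)"
  define W where "W = case_sum (\<lambda>v. (1 - t) * w v) (\<lambda>v. t * w' v)"
  have "(\<Sum>k\<in>F <+> G. W k) = 1"
    using F G by (simp add: sum.Plus W_def flip: sum_distrib_left)
  then have "vec n (\<lambda>j. \<Sum>k\<in>F <+> G. W k * f k $ j) \<in> conv_hull n S"
    using F G assms(3,4) by (intro conv_hull_combination) (auto simp: f_def W_def)
  moreover have "vec n (\<lambda>j. \<Sum>k\<in>F <+> G. W k * f k $ j) = vec n (\<lambda>j. (1 - t) * p $ j + t * q $ j)"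
    using F G by (intro eq_vecI) (auto simp: sum.Plus f_def W_def p q sum_distrib_left mult.assoc)
  ultimately show ?thesis by simp
qed

lemma conv_hull_carrier: "x \<in> conv_hull n S \<Longrightarrow> x \<in> carrier_vec n"
  unfolding conv_hull_def by auto

text \<open>Averaging with weights of sum \<open>1\<close> keeps a lower bound. Signs, upper bounds,
  cover inequalities and cuts on hulls are all obtained from this.\<close>

lemma conv_hull_linear_ge:
  assumes "x \<in> conv_hull n S" "\<And>z. z \<in> S \<Longrightarrow> \<rho> \<le> (\<Sum>j<n. \<alpha> j * z $ j)"
  shows "\<rho> \<le> (\<Sum>j<n. \<alpha> j * x $ j)"
proof -
  from assms(1) obtain F w where F: "finite F" "F \<subseteq> S" "\<forall>v\<in>F. 0 \<le> w v" "(\<Sum>v\<in>F. w v) = 1"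
    and x: "x = vec n (\<lambda>j. \<Sum>v\<in>F. w v * v $ j)" unfolding conv_hull_def by auto
  have "\<rho> = (\<Sum>v\<in>F. w v * \<rho>)" using F by (simp flip: sum_distrib_right)
  also have "\<dots> \<le> (\<Sum>v\<in>F. w v * (\<Sum>j<n. \<alpha> j * v $ j))"
    using F assms(2) by (intro sum_mono mult_left_mono) auto
  also have "\<dots> = (\<Sum>j<n. \<alpha> j * x $ j)"
    unfolding sum_distrib_left x by (subst sum.swap) (auto simp: sum_distrib_left ac_simps intro!: sum.cong)
  finally show ?thesis .
qed

lemma conv_hull_nonneg:
  assumes "x \<in> conv_hull n S" "\<And>z. z \<in> S \<Longrightarrow> 0 \<le> z $ j" "j < n"
  shows "0 \<le> x $ j"
proof -
  have "0 \<le> (\<Sum>k<n. (if k = j then 1 else 0) * x $ k)"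
    using assms(2,3) by (intro conv_hull_linear_ge[OF assms(1)]) (simp add: if_distrib[of "\<lambda>c. c * _"] cong: if_cong)
  with assms(3) show ?thesis by (simp add: if_distrib[of "\<lambda>c. c * _"] cong: if_cong)
qed

section \<open>Moving along a line until a coordinate becomes integral\<close>

lemma move_to_integer:
  fixes a p :: real
  assumes "p \<noteq> 0" "a \<notin> \<int>"
  obtains t where "0 < t" "a + t * p \<in> \<int>"
    "\<And>s. 0 \<le> s \<Longrightarrow> s \<le> t \<Longrightarrow> of_int \<lfloor>a\<rfloor> \<le> a + s * p \<and> a + s * p \<le> of_int \<lceil>a\<rceil>"
proof -
  have fl: "of_int \<lfloor>a\<rfloor> < a" and ce: "a < of_int \<lceil>a\<rceil>"
    using assms(2) by (metis Ints_of_int of_int_floor_le order_less_le)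
      (metis assms(2) Ints_of_int le_of_int_ceiling order_less_le)
  \<comment> \<open>The time \<open>t\<close> is when the next integer in the direction of
    \<open>p\<close> is reached: the ceiling for \<open>p > 0\<close>, the floor for
    \<open>p < 0\<close>.\<close>
  show ?thesis
  proof (cases "p > 0")
    case True
    show ?thesis
    proof (rule that[of "(of_int \<lceil>a\<rceil> - a) / p"])
      fix s assume s: "0 \<le> s" "s \<le> (of_int \<lceil>a\<rceil> - a) / p"
      have "0 \<le> s * p" "s * p \<le> of_int \<lceil>a\<rceil> - a" using s True by (auto simp: field_simps)
      then show "of_int \<lfloor>a\<rfloor> \<le> a + s * p \<and> a + s * p \<le> of_int \<lceil>a\<rceil>" using fl by linarith
    qed (use True ce in auto)
  next
    case False
    then have p: "p < 0" using assms(1) by simp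
    show ?thesis
    proof (rule that[of "(of_int \<lfloor>a\<rfloor> - a) / p"])
      fix s assume s: "0 \<le> s" "s \<le> (of_int \<lfloor>a\<rfloor> - a) / p"
      have "s * p \<le> 0" "of_int \<lfloor>a\<rfloor> - a \<le> s * p"
        using s p mult_nonneg_nonpos[of s p] by (simp_all add: neg_le_divide_eq)
      then show "of_int \<lfloor>a\<rfloor> \<le> a + s * p \<and> a + s * p \<le> of_int \<lceil>a\<rceil>" using ce by linarith
    qed (use p fl in \<open>auto simp: divide_neg_neg\<close>)
  qed
qed

text \<open>The smaller of the two hitting times works: one number is integral then, and neither has
  passed its floor or ceiling. A number with speed zero has no hitting time and simply stays
  put.\<close>

lemma move_pair_to_integer:
  fixes a b p q :: real
  assumes "p \<noteq> 0 \<or> q \<noteq> 0" "a \<notin> \<int>" "b \<notin> \<int>"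
  obtains t where "0 < t" "a + t * p \<in> \<int> \<or> b + t * q \<in> \<int>"
    "of_int \<lfloor>a\<rfloor> \<le> a + t * p" "a + t * p \<le> of_int \<lceil>a\<rceil>"
    "of_int \<lfloor>b\<rfloor> \<le> b + t * q" "b + t * q \<le> of_int \<lceil>b\<rceil>"
proof -
  have still: "of_int \<lfloor>c\<rfloor> \<le> c + t * 0 \<and> c + t * 0 \<le> of_int \<lceil>c\<rceil>" for c t :: real by simp
  show ?thesis
  proof (cases "p = 0")
    case True
    then obtain t where "0 < t" "b + t * q \<in> \<int>"
      "\<And>s. 0 \<le> s \<Longrightarrow> s \<le> t \<Longrightarrow> of_int \<lfloor>b\<rfloor> \<le> b + s * q \<and> b + s * q \<le> of_int \<lceil>b\<rceil>"
      using assms move_to_integer[of q b] by blast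
    then show ?thesis using that[of t] True still by force
  next
    case p: False
    then obtain t where t: "0 < t" "a + t * p \<in> \<int>"
      "\<And>s. 0 \<le> s \<Longrightarrow> s \<le> t \<Longrightarrow> of_int \<lfloor>a\<rfloor> \<le> a + s * p \<and> a + s * p \<le> of_int \<lceil>a\<rceil>"
      using assms move_to_integer[of p a] by blast
    show ?thesis
    proof (cases "q = 0")
      case True
      then show ?thesis using that[of t] t still by force
    next
      case False
      then obtain t' where t': "0 < t'" "b + t' * q \<in> \<int>"
        "\<And>s. 0 \<le> s \<Longrightarrow> s \<le> t' \<Longrightarrow> of_int \<lfloor>b\<rfloor> \<le> b + s * q \<and> b + s * q \<le> of_int \<lceil>b\<rceil>"
        using assms move_to_integer[of q b] by blast
      show ?thesis
        using that[of "min t t'"] t t' by (smt (verit, best) min_def)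
    qed
  qed
qed

text \<open>Candidates for rounding \<open>y\<close>: an integral coordinate stays fixed because its
  floor and ceiling coincide, and the box keeps rounded points within integral bounds.\<close>

definition box_knapsack :: "nat \<Rightarrow> (nat \<Rightarrow> real) \<Rightarrow> real \<Rightarrow> real vec \<Rightarrow> real vec set" where
  "box_knapsack n \<alpha> \<rho> y =
     {z \<in> carrier_vec n. (\<forall>j<n. z $ j \<in> \<int> \<and> of_int \<lfloor>y $ j\<rfloor> \<le> z $ j \<and> z $ j \<le> of_int \<lceil>y $ j\<rceil>) \<and>
        \<rho> \<le> (\<Sum>j<n. \<alpha> j * z $ j)}"

text \<open>Floors and ceilings stay within integer limits, so the boxes only shrink as rounding
  proceeds, and a hull from the induction hypothesis can be reused for the original point.\<close>

lemma box_knapsack_mono: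
  assumes "\<And>j. j < n \<Longrightarrow> of_int \<lfloor>y $ j\<rfloor> \<le> y' $ j \<and> y' $ j \<le> of_int \<lceil>y $ j\<rceil>"
  shows "box_knapsack n \<alpha> \<rho> y' \<subseteq> box_knapsack n \<alpha> \<rho> y"
proof -
  have "of_int \<lfloor>y $ j\<rfloor> \<le> (of_int \<lfloor>y' $ j\<rfloor> :: real) \<and> of_int \<lceil>y' $ j\<rceil> \<le> (of_int \<lceil>y $ j\<rceil> :: real)" if "j < n" for j
    using assms[OF that] by (simp add: le_floor_iff ceiling_le_iff)
  then show ?thesis unfolding box_knapsack_def by (blast intro: order_trans)
qed

text \<open>\<open>y\<close> lies on the segment between the two shifted points, at the fraction
  \<open>s / (s + t)\<close> of the way from the backward one.\<close>

lemma conv_hull_shift: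
  assumes y: "y \<in> carrier_vec n" and st: "0 < s" "0 < t"
    and "vec n (\<lambda>j. y $ j + t * d j) \<in> conv_hull n S"
    and "vec n (\<lambda>j. y $ j + (- s) * d j) \<in> conv_hull n S"
  shows "y \<in> conv_hull n S"
proof -
  define e where "e = s / (s + t)"
  have "e * (s + t) = s" "0 \<le> e" "e \<le> 1" using st by (simp_all add: e_def)
  then have e: "e * s + e * t = s" "0 \<le> e" "e \<le> 1" by (simp_all only: distrib_left)
  have "(1 - e) * (y $ j + - s * d j) + e * (y $ j + t * d j) = y $ j + (e * s + e * t - s) * d j" for j
    by (simp add: algebra_simps)
  then have eq: "vec n (\<lambda>j. (1 - e) * vec n (\<lambda>j. y $ j + - s * d j) $ j
                      + e * vec n (\<lambda>j. y $ j + t * d j) $ j) = y"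
    using y by (intro eq_vecI) (simp_all add: e)
  show ?thesis
    using conv_hull_convex[OF assms(5,4), of "e"] e unfolding eq by simp
qed

text \<open>Dependent rounding: two fractional coordinates can be moved against each other in a
  direction orthogonal to \<open>\<alpha>\<close> until one of them is integral. Rounding the last fractional
  coordinate costs at most \<open>\<rho>\<close>.\<close>

lemma knapsack_rounding:
  assumes \<alpha>: "\<And>j. j < n \<Longrightarrow> 0 \<le> \<alpha> j \<and> \<alpha> j \<le> \<rho>" and "0 \<le> \<rho>"
    and "y \<in> carrier_vec n" "2 * \<rho> \<le> (\<Sum>j<n. \<alpha> j * y $ j)"
  shows "y \<in> conv_hull n (box_knapsack n \<alpha> \<rho> y)"
  using assms(3,4)
proof (induction "card {j. j < n \<and> y $ j \<notin> \<int>}" arbitrary: y rule: less_induct)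
  case less
  let ?S = "box_knapsack n \<alpha> \<rho> y"
  let ?frac = "\<lambda>y. {j. j < n \<and> y $ j \<notin> \<int>}"
  consider "?frac y = {}" | j where "?frac y = {j}"
    | j k where "j < n" "k < n" "j \<noteq> k" "y $ j \<notin> \<int>" "y $ k \<notin> \<int>"
    by blast
  then show ?case
  proof cases
    case 1
    then have "y \<in> ?S" using less.prems \<open>0 \<le> \<rho>\<close> by (auto simp: box_knapsack_def)
    then show ?thesis using less.prems by (simp add: conv_hull_base)
  next
    case (2 j)
    then have j: "j < n" "y $ j \<notin> \<int>" by auto
    have int: "y $ i \<in> \<int>" if "i < n" "i \<noteq> j" for i using 2 that by auto
    define d where "d i = (if i = j then 1 else 0 :: real)" for i
    have sum: "(\<Sum>i<n. \<alpha> i * (y $ i + s * d i)) = (\<Sum>i<n. \<alpha> i * y $ i) + s * \<alpha> j" for s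
    proof -
      have "(\<Sum>i<n. \<alpha> i * (y $ i + s * d i)) = (\<Sum>i<n. \<alpha> i * y $ i) + (\<Sum>i<n. if i = j then s * \<alpha> i else 0)"
        unfolding d_def sum.distrib[symmetric] by (intro sum.cong) (auto simp: algebra_simps)
      then show ?thesis using j by simp
    qed
    have fl: "of_int \<lfloor>y $ j\<rfloor> < y $ j" and ce: "y $ j < of_int \<lceil>y $ j\<rceil>"
      using j(2) by (metis Ints_of_int of_int_floor_le order_less_le)
        (metis j(2) Ints_of_int le_of_int_ceiling order_less_le)
    have mem: "vec n (\<lambda>i. y $ i + s * d i) \<in> ?S"
      if "y $ j + s \<in> \<int>" "of_int \<lfloor>y $ j\<rfloor> \<le> y $ j + s" "y $ j + s \<le> of_int \<lceil>y $ j\<rceil>" "- 1 \<le> s" for s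
    proof -
      \<comment> \<open>A step down by at most \<open>1\<close> loses at most
        \<open>\<alpha> j\<close>, hence at most \<open>\<rho>\<close> of the available
        \<open>2 * \<rho>\<close>.\<close>
      have "- 1 * \<alpha> j \<le> s * \<alpha> j" using that \<alpha>[OF j(1)] by (intro mult_right_mono) auto
      then have "\<rho> \<le> (\<Sum>i<n. \<alpha> i * (y $ i + s * d i))"
        using \<alpha>[OF j(1)] less.prems(2) unfolding sum by linarith
      then show ?thesis using that int by (auto simp: box_knapsack_def d_def)
    qed
    let ?t = "of_int \<lceil>y $ j\<rceil> - y $ j" and ?s = "y $ j - of_int \<lfloor>y $ j\<rfloor>"
    have "?s \<le> 1" by linarith
    have "vec n (\<lambda>i. y $ i + ?t * d i) \<in> ?S" "vec n (\<lambda>i. y $ i + (- ?s) * d i) \<in> ?S"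
      using fl ce \<open>?s \<le> 1\<close> by (intro mem; simp add: floor_le_ceiling)+
    then show ?thesis
      using fl ce
      by (intro conv_hull_shift[OF less.prems(1) _ _ conv_hull_base conv_hull_base, of ?s ?t d])
        (assumption | simp)+
  next
    case (3 j k)
    \<comment> \<open>A nonzero direction orthogonal to \<open>\<alpha>\<close> in these two
      coordinates; if both coefficients vanish, any direction qualifies.\<close>
    obtain p q where pq: "p \<noteq> 0 \<or> q \<noteq> 0" "\<alpha> j * p + \<alpha> k * q = 0"
    proof (cases "\<alpha> j = 0 \<and> \<alpha> k = 0")
      case True then show ?thesis using that[of 1 0] by simp
    next
      case False then show ?thesis using that[of "\<alpha> k" "- \<alpha> j"] by auto
    qed
    define d where "d i = (if i = j then p else if i = k then q else 0)" for i
    have sum: "(\<Sum>i<n. \<alpha> i * (y $ i + s * d i)) = (\<Sum>i<n. \<alpha> i * y $ i)" for s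
    proof -
      have "(\<Sum>i<n. \<alpha> i * (y $ i + s * d i)) = (\<Sum>i<n. \<alpha> i * y $ i)
        + s * ((\<Sum>i<n. if i = j then \<alpha> j * p else 0) + (\<Sum>i<n. if i = k then \<alpha> k * q else 0))"
        unfolding d_def sum_distrib_left sum.distrib[symmetric] using 3(3)
        by (intro sum.cong) (auto simp: algebra_simps)
      then show ?thesis using 3 pq(2) by simp
    qed
    have mem: "vec n (\<lambda>i. y $ i + s * d i) \<in> conv_hull n ?S"
      if "y $ j + s * p \<in> \<int> \<or> y $ k + s * q \<in> \<int>"
        "of_int \<lfloor>y $ j\<rfloor> \<le> y $ j + s * p" "y $ j + s * p \<le> of_int \<lceil>y $ j\<rceil>"
        "of_int \<lfloor>y $ k\<rfloor> \<le> y $ k + s * q" "y $ k + s * q \<le> of_int \<lceil>y $ k\<rceil>" for s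
    proof -
      let ?y = "vec n (\<lambda>i. y $ i + s * d i)"
      have at: "?y $ j = y $ j + s * p" "?y $ k = y $ k + s * q"
        using 3 by (simp_all add: d_def)
      \<comment> \<open>Only \<open>j\<close> and \<open>k\<close> move, both fractional before, and
        one of them is now integral; hence the number of fractional coordinates drops.\<close>
      have "?frac ?y \<subseteq> ?frac y"
      proof
        fix i assume "i \<in> ?frac ?y"
        then show "i \<in> ?frac y" using 3 by (cases "i = j \<or> i = k") (auto simp: d_def)
      qed
      moreover have "j \<notin> ?frac ?y \<or> k \<notin> ?frac ?y" using that(1) unfolding mem_Collect_eq at by blast
      moreover have "j \<in> ?frac y" "k \<in> ?frac y" using 3 by simp_all
      ultimately have "?frac ?y \<subset> ?frac y" by blast
      then have card: "card (?frac ?y) < card (?frac y)" by (intro psubset_card_mono) simp_all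
      have "(\<Sum>i<n. \<alpha> i * ?y $ i) = (\<Sum>i<n. \<alpha> i * y $ i)"
        unfolding sum[of s, symmetric] by (intro sum.cong) simp_all
      with less.prems(2) have "?y \<in> conv_hull n (box_knapsack n \<alpha> \<rho> ?y)"
        by (intro less.hyps[OF card]) simp_all
      moreover have "box_knapsack n \<alpha> \<rho> ?y \<subseteq> ?S"
        using that 3 by (intro box_knapsack_mono) (auto simp: d_def)
      ultimately show ?thesis using conv_hull_mono by blast
    qed
    obtain t where t: "0 < t" "vec n (\<lambda>i. y $ i + t * d i) \<in> conv_hull n ?S"
      by (rule move_pair_to_integer[OF pq(1) 3(4,5)]) (use mem in blast)
    have "- p \<noteq> 0 \<or> - q \<noteq> 0" using pq by simp
    then obtain s where s: "0 < s" "vec n (\<lambda>i. y $ i + (- s) * d i) \<in> conv_hull n ?S"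
    proof (rule move_pair_to_integer[OF _ 3(4,5)])
      fix s assume "0 < s" "y $ j + s * - p \<in> \<int> \<or> y $ k + s * - q \<in> \<int>"
        "of_int \<lfloor>y $ j\<rfloor> \<le> y $ j + s * - p" "y $ j + s * - p \<le> of_int \<lceil>y $ j\<rceil>"
        "of_int \<lfloor>y $ k\<rfloor> \<le> y $ k + s * - q" "y $ k + s * - q \<le> of_int \<lceil>y $ k\<rceil>"
      then show ?thesis using that[of s] mem[of "- s"] by simp
    qed
    show ?thesis
      by (rule conv_hull_shift[OF less.prems(1) s(1) t(1) t(2) s(2)])
  qed
qed

section \<open>Closures in coordinates\<close>

text \<open>The guard keeps \<open>the_enat\<close> away from infinity, where its value is
  unspecified.\<close>

lemma below_bounds_iff:
  assumes "u \<in> carrier_vec n"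
  shows "below_bounds x u \<longleftrightarrow> (\<forall>j<n. u $ j \<noteq> \<infinity> \<longrightarrow> x $ j \<le> real (the_enat (u $ j)))"
proof -
  have "ereal r \<le> ereal_of_enat e \<longleftrightarrow> (e \<noteq> \<infinity> \<longrightarrow> r \<le> real (the_enat e))" for r e
    by (cases e) auto
  then show ?thesis using assms by (simp add: below_bounds_def)
qed

lemma mem_covering_polyhedron:
  assumes "A \<in> carrier_mat m n" "b \<in> carrier_vec m"
  shows "x \<in> covering_polyhedron A b u \<longleftrightarrow>
    x \<in> carrier_vec n \<and> (\<forall>j<n. 0 \<le> x $ j) \<and> (\<forall>i<m. b $ i \<le> (\<Sum>j<n. A $$ (i, j) * x $ j)) \<and>
    below_bounds x u"
proof -
  have "(A *\<^sub>v x) $ i = (\<Sum>j<n. A $$ (i, j) * x $ j)" if "x \<in> carrier_vec n" "i < m" for i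
    using that assms by (simp add: scalar_prod_def lessThan_atLeast0)
  moreover have "b \<le> A *\<^sub>v x \<longleftrightarrow> (\<forall>i<m. b $ i \<le> (A *\<^sub>v x) $ i)"
    using assms by (simp add: less_eq_vec_def del: index_mult_mat_vec)
  moreover have "0\<^sub>v n \<le> x \<longleftrightarrow> (\<forall>j<n. 0 \<le> x $ j)" if "x \<in> carrier_vec n"
    using that by (auto simp: less_eq_vec_def)
  moreover have "dim_col A = n" using assms by simp
  ultimately show ?thesis unfolding covering_polyhedron_def by auto
qed

lemma mem_CG_closure:
  assumes "P \<subseteq> carrier_vec n"
  shows "x \<in> CG_closure n P \<longleftrightarrow> x \<in> P \<and>
    (\<forall>a \<beta>. (\<forall>j<n. a j \<in> \<int>) \<and> (\<forall>y\<in>P. \<beta> \<le> (\<Sum>j<n. a j * y $ j)) \<longrightarrow>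
       of_int \<lceil>\<beta>\<rceil> \<le> (\<Sum>j<n. a j * x $ j))"
proof -
  have sp: "a \<bullet> y = (\<Sum>j<n. a $ j * y $ j)" if "y \<in> P" for a y
    using that assms by (auto simp: scalar_prod_def lessThan_atLeast0)
  have *: "of_int \<lceil>\<beta>\<rceil> \<le> (\<Sum>j<n. a j * x $ j)"
    if "\<And>a \<beta>. a \<in> carrier_vec n \<Longrightarrow> (\<forall>j<n. a $ j \<in> \<int>) \<and> (\<forall>y\<in>P. \<beta> \<le> a \<bullet> y) \<Longrightarrow> of_int \<lceil>\<beta>\<rceil> \<le> a \<bullet> x"
      "x \<in> P" "\<forall>j<n. a j \<in> \<int>" "\<forall>y\<in>P. \<beta> \<le> (\<Sum>j<n. a j * y $ j)" for a \<beta>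
    using that(1)[of "vec n a" \<beta>] that(2-) by (auto simp: sp)
  show ?thesis
    unfolding CG_closure_def using * by (auto simp: sp)
qed

lemma mem_chvatal_gomory:
  assumes "A \<in> carrier_mat m n"
  shows "x \<in> chvatal_gomory A b u \<longleftrightarrow> x \<in> covering_polyhedron A b u \<and>
    (\<forall>a \<beta>. (\<forall>j<n. a j \<in> \<int>) \<and> (\<forall>y\<in>covering_polyhedron A b u. \<beta> \<le> (\<Sum>j<n. a j * y $ j)) \<longrightarrow>
       of_int \<lceil>\<beta>\<rceil> \<le> (\<Sum>j<n. a j * x $ j))"
proof -
  have "covering_polyhedron A b u \<subseteq> carrier_vec n"
    using assms by (auto simp: covering_polyhedron_def)
  then show ?thesis using mem_CG_closure assms by (auto simp: chvatal_gomory_def)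
qed

definition aggregated_points :: "nat \<Rightarrow> nat \<Rightarrow> real mat \<Rightarrow> real vec \<Rightarrow> enat vec \<Rightarrow> (nat \<Rightarrow> real) \<Rightarrow> real vec set"
  where "aggregated_points m n A b u l =
    {z \<in> carrier_vec n. (\<forall>j<n. z $ j \<in> \<nat>) \<and>
       (\<Sum>i<m. l i * b $ i) \<le> (\<Sum>i<m. l i * (\<Sum>j<n. A $$ (i, j) * z $ j)) \<and> below_bounds z u}"

lemma mem_aggregation:
  assumes "A \<in> carrier_mat m n" "b \<in> carrier_vec m"
  shows "x \<in> aggregation A b u \<longleftrightarrow>
    (\<forall>l. (\<forall>i<m. 0 \<le> l i) \<longrightarrow> x \<in> conv_hull n (aggregated_points m n A b u l))"
proof -
  have set_eq: "{z \<in> carrier_vec (dim_col A). (\<forall>j<dim_col A. z $ j \<in> \<nat>) \<and> l \<bullet> b \<le> l \<bullet> (A *\<^sub>v z) \<and> below_bounds z u}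
      = aggregated_points m n A b u (($) l)" for l
  proof -
    have "l \<bullet> b = (\<Sum>i<m. l $ i * b $ i)"
      using assms by (simp add: scalar_prod_def lessThan_atLeast0)
    moreover have "l \<bullet> (A *\<^sub>v z) = (\<Sum>i<m. l $ i * (\<Sum>j<n. A $$ (i, j) * z $ j))" if "z \<in> carrier_vec n" for z
      using that assms by (auto simp: scalar_prod_def lessThan_atLeast0 intro!: sum.cong)
    ultimately show ?thesis using assms unfolding aggregated_points_def by auto
  qed
  have *: "x \<in> conv_hull n (aggregated_points m n A b u l)"
    if "\<And>l. l \<in> carrier_vec m \<Longrightarrow> 0\<^sub>v m \<le> l \<Longrightarrow> x \<in> conv_hull n (aggregated_points m n A b u (($) l))"
      "\<forall>i<m. 0 \<le> l i" for l
  proof -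
    have "aggregated_points m n A b u (($) (vec m l)) = aggregated_points m n A b u l"
      by (simp add: aggregated_points_def)
    then show ?thesis using that(1)[of "vec m l"] that(2) by (simp add: less_eq_vec_def)
  qed
  have "x \<in> aggregation A b u \<longleftrightarrow>
    (\<forall>l \<in> carrier_vec m. 0\<^sub>v m \<le> l \<longrightarrow> x \<in> conv_hull n (aggregated_points m n A b u (($) l)))"
    unfolding aggregation_def set_eq using assms by auto
  moreover have "\<forall>i<m. 0 \<le> l $ i" if "l \<in> carrier_vec m" "0\<^sub>v m \<le> l" for l :: "real vec"
    using that by (auto simp: less_eq_vec_def)
  ultimately show ?thesis using * by blast
qed

section \<open>A covering system and the closures of its single rows\<close>

locale covering_system =
  fixes m n :: nat and A :: "real mat" and b :: "real vec" and u :: "enat vec"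
  assumes A: "A \<in> carrier_mat m n" and b: "b \<in> carrier_vec m" and u: "u \<in> carrier_vec n"
    and rows: "0 < m" and A_nonneg: "\<And>i j. i < m \<Longrightarrow> j < n \<Longrightarrow> 0 \<le> A $$ (i, j)"
    and b_nonneg: "\<And>i. i < m \<Longrightarrow> 0 \<le> b $ i"
begin

definition row_mat :: "nat \<Rightarrow> real mat" where "row_mat i = mat_of_rows n [row A i]"
definition row_rhs :: "nat \<Rightarrow> real vec" where "row_rhs i = vec_of_list [b $ i]"

lemma row_data: "row_mat i \<in> carrier_mat 1 n" "row_rhs i \<in> carrier_vec 1" "row_rhs i $ 0 = b $ i"
  "i < m \<Longrightarrow> j < n \<Longrightarrow> row_mat i $$ (0, j) = A $$ (i, j)"
  using A by (auto simp: mat_of_rows_index carrier_vecI row_mat_def row_rhs_def)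

lemma mem_one_row: "x \<in> one_row M A b u \<longleftrightarrow> (\<forall>i<m. x \<in> M (row_mat i) (row_rhs i) u)"
  using A by (auto simp: one_row_def row_mat_def row_rhs_def)

lemma mem_row_polyhedron:
  assumes "i < m"
  shows "x \<in> covering_polyhedron (row_mat i) (row_rhs i) u \<longleftrightarrow>
    x \<in> carrier_vec n \<and> (\<forall>j<n. 0 \<le> x $ j) \<and> b $ i \<le> (\<Sum>j<n. A $$ (i, j) * x $ j) \<and> below_bounds x u"
  unfolding mem_covering_polyhedron[OF row_data(1,2)] using assms by (simp add: row_data)

definition row_points :: "nat \<Rightarrow> real vec set" where
  "row_points i = {z \<in> carrier_vec n. (\<forall>j<n. z $ j \<in> \<nat>) \<and>
     b $ i \<le> (\<Sum>j<n. A $$ (i, j) * z $ j) \<and> below_bounds z u}"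

lemma aggregated_points_row:
  assumes "i < m"
  shows "aggregated_points 1 n (row_mat i) (row_rhs i) u l =
    {z \<in> carrier_vec n. (\<forall>j<n. z $ j \<in> \<nat>) \<and>
      l 0 * b $ i \<le> l 0 * (\<Sum>j<n. A $$ (i, j) * z $ j) \<and> below_bounds z u}"
  using assms by (simp add: aggregated_points_def row_data)

text \<open>The multiplier \<open>1\<close> returns the row itself, and every non-negative
  multiplier keeps all points of the row, so the hull for \<open>1\<close> is the smallest in the
  intersection.\<close>

lemma aggregation_row:
  assumes "i < m"
  shows "x \<in> aggregation (row_mat i) (row_rhs i) u \<longleftrightarrow> x \<in> conv_hull n (row_points i)"
proof
  assume "x \<in> aggregation (row_mat i) (row_rhs i) u"
  then have "x \<in> conv_hull n (aggregated_points 1 n (row_mat i) (row_rhs i) u (\<lambda>_. 1))"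
    unfolding mem_aggregation[OF row_data(1,2)] by simp
  then show "x \<in> conv_hull n (row_points i)"
    unfolding aggregated_points_row[OF assms] row_points_def by simp
next
  assume x: "x \<in> conv_hull n (row_points i)"
  have "row_points i \<subseteq> aggregated_points 1 n (row_mat i) (row_rhs i) u l" if "0 \<le> l 0" for l
    unfolding aggregated_points_row[OF assms] row_points_def using that by (auto intro: mult_left_mono)
  then show "x \<in> aggregation (row_mat i) (row_rhs i) u"
    unfolding mem_aggregation[OF row_data(1,2)] using x conv_hull_mono[of _ _ n] by blast
qed

lemma one_row_aggregation_superset: "aggregation A b u \<subseteq> one_row aggregation A b u"
proof
  fix x assume x: "x \<in> aggregation A b u"
  have "x \<in> conv_hull n (row_points i)" if i: "i < m" for i
  proof -
    \<comment> \<open>The unit multiplier at \<open>i\<close> turns the aggregated row into row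
      \<open>i\<close>.\<close>
    define l where "l k = (if k = i then 1 else 0 :: real)" for k
    have "(\<Sum>k<m. l k * f k) = f i" for f
      using i by (simp add: l_def if_distrib[of "\<lambda>c. c * _"] cong: if_cong)
    then have "aggregated_points m n A b u l = row_points i"
      by (simp add: aggregated_points_def row_points_def)
    moreover have "x \<in> conv_hull n (aggregated_points m n A b u l)"
      using x unfolding mem_aggregation[OF A b] by (simp add: l_def)
    ultimately show ?thesis by simp
  qed
  then show "x \<in> one_row aggregation A b u" by (simp add: mem_one_row aggregation_row)
qed

text \<open>A row polyhedron contains the full one, so a cut valid for the row is also valid for the
  full system.\<close>

lemma one_row_chvatal_gomory_superset: "chvatal_gomory A b u \<subseteq> one_row chvatal_gomory A b u"
proof
  fix x assume x: "x \<in> chvatal_gomory A b u"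
  have "x \<in> chvatal_gomory (row_mat i) (row_rhs i) u" if i: "i < m" for i
  proof -
    have "covering_polyhedron A b u \<subseteq> covering_polyhedron (row_mat i) (row_rhs i) u"
      using i by (auto simp: mem_row_polyhedron mem_covering_polyhedron[OF A b])
    then show ?thesis
      using x unfolding mem_chvatal_gomory[OF A] mem_chvatal_gomory[OF row_data(1)] by blast
  qed
  then show "x \<in> one_row chvatal_gomory A b u" by (simp add: mem_one_row)
qed

text \<open>Integer points survive every cut, because an integral left-hand side that is at least
  \<open>\<beta>\<close> is at least its ceiling; convex combinations inherit this. In the tightness
  example, membership in the hulls thereby serves both operators.\<close>

lemma row_hull_in_chvatal_gomory:
  assumes i: "i < m" and x: "x \<in> conv_hull n (row_points i)"
  shows "x \<in> chvatal_gomory (row_mat i) (row_rhs i) u"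
proof -
  have "0 \<le> x $ j" if "j < n" for j
    using conv_hull_nonneg[OF x _ that] that by (auto simp: row_points_def Nats_altdef2)
  moreover have "b $ i \<le> (\<Sum>j<n. A $$ (i, j) * x $ j)"
    by (rule conv_hull_linear_ge[OF x]) (auto simp: row_points_def)
  moreover have "x $ j \<le> real (the_enat (u $ j))" if j: "j < n" "u $ j \<noteq> \<infinity>" for j
  proof -
    \<comment> \<open>An upper bound is read as a lower bound for the negated unit functional, so
      that the hull inequality applies.\<close>
    have pick: "(\<Sum>k<n. (if k = j then - 1 else 0) * z k) = - z j" for z :: "nat \<Rightarrow> real"
      using j(1) by (simp add: if_distrib[of "\<lambda>c. c * _"] cong: if_cong)
    have "- real (the_enat (u $ j)) \<le> (\<Sum>k<n. (if k = j then - 1 else 0) * x $ k)"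
      by (rule conv_hull_linear_ge[OF x], unfold pick)
        (use j in \<open>auto simp: row_points_def below_bounds_iff[OF u]\<close>)
    then show ?thesis unfolding pick by simp
  qed
  ultimately have "x \<in> covering_polyhedron (row_mat i) (row_rhs i) u"
    using conv_hull_carrier[OF x] by (simp add: mem_row_polyhedron[OF i] below_bounds_iff[OF u])
  moreover have "of_int \<lceil>\<beta>\<rceil> \<le> (\<Sum>j<n. a j * x $ j)"
    if a: "\<forall>j<n. a j \<in> \<int>" and \<beta>: "\<forall>y\<in>covering_polyhedron (row_mat i) (row_rhs i) u. \<beta> \<le> (\<Sum>j<n. a j * y $ j)"
    for a \<beta>
  proof (rule conv_hull_linear_ge[OF x])
    fix z assume z: "z \<in> row_points i"
    then have "z \<in> covering_polyhedron (row_mat i) (row_rhs i) u"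
      by (auto simp: mem_row_polyhedron[OF i] row_points_def Nats_altdef2)
    then have "\<beta> \<le> (\<Sum>j<n. a j * z $ j)" using \<beta> by blast
    moreover have "(\<Sum>j<n. a j * z $ j) \<in> \<int>"
      using z a by (intro Ints_sum Ints_mult) (auto simp: row_points_def Nats_altdef2)
    ultimately show "of_int \<lceil>\<beta>\<rceil> \<le> (\<Sum>j<n. a j * z $ j)"
      by (auto elim!: Ints_cases simp: ceiling_le_iff)
  qed
  ultimately show ?thesis unfolding mem_chvatal_gomory[OF row_data(1)] by blast
qed

end

section \<open>The factor two\<close>

text \<open>\<open>T\<close> is paid for at its bounds \<open>v\<close>, \<open>r\<close> remains,
  and coefficients are truncated at \<open>r\<close>. An item outside \<open>T\<close> with
  coefficient at least \<open>r\<close> and value at least \<open>1\<close> covers \<open>r\<close>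
  alone; otherwise truncation changes no item that occurs, and the plain residual inequality is
  left.\<close>

lemma knapsack_cover:
  fixes a v z :: "nat \<Rightarrow> real"
  assumes a: "\<And>j. j < n \<Longrightarrow> 0 \<le> a j" and z: "\<And>j. j < n \<Longrightarrow> z j \<in> \<nat>"
    and T: "\<And>j. j < n \<Longrightarrow> j \<in> T \<Longrightarrow> z j \<le> v j"
    and \<beta>: "\<beta> \<le> (\<Sum>j<n. a j * z j)"
    and r: "r = max 0 (\<beta> - (\<Sum>j<n. if j \<in> T then a j * v j else 0))"
  shows "r \<le> (\<Sum>j<n. (if j \<in> T then 0 else min (a j) r) * z j)"
proof -
  have z0: "0 \<le> z j" if "j < n" for j using z[OF that] by (simp add: Nats_altdef2)
  have "0 \<le> r" using r by simp
  then have nonneg: "0 \<le> (if j \<in> T then 0 else min (a j) r) * z j" if "j < n" for j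
    using a z0 that by simp
  consider "r = 0" | k where "k < n" "k \<notin> T" "r \<le> a k" "1 \<le> z k" "r > 0"
    | "r > 0" "\<And>k. k < n \<Longrightarrow> k \<notin> T \<Longrightarrow> a k < r \<or> z k < 1"
    using \<open>0 \<le> r\<close> by fastforce
  then show ?thesis
  proof cases
    case 1
    have "0 \<le> (\<Sum>j<n. (if j \<in> T then 0 else min (a j) r) * z j)"
      by (rule sum_nonneg) (use nonneg in simp)
    then show ?thesis using 1 by simp
  next
    case (2 k)
    have "r * 1 \<le> r * z k" using 2 by (intro mult_left_mono) auto
    also have "r * z k = (if k \<in> T then 0 else min (a k) r) * z k" using 2 by simp
    also have "\<dots> \<le> (\<Sum>j<n. (if j \<in> T then 0 else min (a j) r) * z j)"
      by (rule member_le_sum) (use nonneg 2 in simp_all)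
    finally show ?thesis by simp
  next
    case 3
    have "r = \<beta> - (\<Sum>j<n. if j \<in> T then a j * v j else 0)" using r 3(1) by simp
    also have "\<dots> \<le> (\<Sum>j<n. a j * z j - (if j \<in> T then a j * v j else 0))"
      using \<beta> by (simp add: sum_subtractf)
    also have "\<dots> \<le> (\<Sum>j<n. (if j \<in> T then 0 else min (a j) r) * z j)"
    proof (rule sum_mono)
      fix j assume "j \<in> {..<n}"
      then have j: "j < n" by simp
      show "a j * z j - (if j \<in> T then a j * v j else 0) \<le> (if j \<in> T then 0 else min (a j) r) * z j"
      proof (cases "j \<in> T")
        case True
        then show ?thesis using a[OF j] T[OF j] by (simp add: mult_left_mono)
      next
        case False
        \<comment> \<open>By integrality a value below \<open>1\<close> is \<open>0\<close>, so
          truncating its coefficient loses nothing.\<close>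
        from z[OF j] obtain k where "z j = real k" by (auto elim: Nats_cases)
        then have "z j < 1 \<Longrightarrow> z j = 0" by simp
        then show ?thesis using 3(2)[OF j False] False by auto
      qed
    qed
    finally show ?thesis .
  qed
qed

section \<open>The doubled point, capped at the bounds\<close>

context covering_system
begin

definition bound :: "nat \<Rightarrow> real" where "bound j = real (the_enat (u $ j))"

definition saturated :: "real vec \<Rightarrow> nat set" where
  "saturated x = {j. j < n \<and> u $ j \<noteq> \<infinity> \<and> bound j < 2 * x $ j}"

definition doubled :: "real vec \<Rightarrow> real vec" where
  "doubled x = vec n (\<lambda>j. if j \<in> saturated x then bound j else 2 * x $ j)"

lemma bound_nonneg: "0 \<le> bound j"
  by (simp add: bound_def)

lemma doubled_carrier: "doubled x \<in> carrier_vec n"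
  by (simp add: doubled_def)

lemma doubled_nth: "j < n \<Longrightarrow> doubled x $ j = (if j \<in> saturated x then bound j else 2 * x $ j)"
  by (simp add: doubled_def)

lemma below_bounds_bound: "below_bounds x u \<longleftrightarrow> (\<forall>j<n. u $ j \<noteq> \<infinity> \<longrightarrow> x $ j \<le> bound j)"
  using below_bounds_iff[OF u] by (simp add: bound_def)

lemma doubled_below: "below_bounds (doubled x) u"
  by (auto simp: below_bounds_bound doubled_nth saturated_def not_less)

lemma doubled_nonneg: "j < n \<Longrightarrow> 0 \<le> x $ j \<Longrightarrow> 0 \<le> doubled x $ j"
  by (simp add: doubled_nth bound_nonneg)

lemma doubled_le: "j < n \<Longrightarrow> doubled x $ j \<le> 2 * x $ j"
  by (auto simp: doubled_nth saturated_def)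

text \<open>The cover inequalities of the rows do not depend on the multipliers, so one doubled
  point serves all of them. Rounding is applied to the truncated residual system; adding the
  saturated coordinates at their bounds restores the original aggregated row.\<close>

lemma doubled_in_aggregation:
  assumes x: "x \<in> one_row aggregation A b u"
  shows "doubled x \<in> aggregation A b u"
proof -
  let ?T = "saturated x"
  have xi: "x \<in> conv_hull n (row_points i)" if "i < m" for i
    using x that by (simp add: mem_one_row aggregation_row)
  have x0: "0 \<le> x $ j" if "j < n" for j
    using conv_hull_nonneg[OF xi[OF rows] _ that] that by (auto simp: row_points_def Nats_altdef2)
  define fixed where "fixed i = (\<Sum>j<n. if j \<in> ?T then A $$ (i, j) * bound j else 0)" for i
  define r where "r i = max 0 (b $ i - fixed i)" for i
  define coef where "coef i j = (if j \<in> ?T then 0 else min (A $$ (i, j)) (r i))" for i j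
  have r0: "0 \<le> r i" for i by (simp add: r_def)
  have coef: "0 \<le> coef i j" "coef i j \<le> r i" "coef i j \<le> A $$ (i, j)" if "i < m" "j < n" for i j
    using A_nonneg[OF that] r0[of i] by (auto simp: coef_def)
  have cover: "r i \<le> (\<Sum>j<n. coef i j * x $ j)" if i: "i < m" for i
  proof (rule conv_hull_linear_ge[OF xi[OF i]])
    fix z assume z: "z \<in> row_points i"
    show "r i \<le> (\<Sum>j<n. coef i j * z $ j)"
      unfolding coef_def
    proof (rule knapsack_cover)
      show "r i = max 0 (b $ i - (\<Sum>j<n. if j \<in> ?T then A $$ (i, j) * bound j else 0))"
        by (simp add: r_def fixed_def)
    qed (use z A_nonneg[OF i] in \<open>auto simp: row_points_def below_bounds_bound saturated_def\<close>)
  qed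
  have "doubled x \<in> conv_hull n (aggregated_points m n A b u l)" if l: "\<forall>i<m. 0 \<le> l i" for l
  proof -
    define \<alpha> where "\<alpha> j = (\<Sum>i<m. l i * coef i j)" for j
    define \<rho> where "\<rho> = (\<Sum>i<m. l i * r i)"
    have \<alpha>_sum: "(\<Sum>j<n. \<alpha> j * z j) = (\<Sum>i<m. l i * (\<Sum>j<n. coef i j * z j))" for z
      unfolding \<alpha>_def sum_distrib_left sum_distrib_right by (subst sum.swap) (simp add: mult.assoc)
    have "doubled x \<in> conv_hull n (box_knapsack n \<alpha> \<rho> (doubled x))"
    proof (rule knapsack_rounding)
      fix j assume "j < n"
      then show "0 \<le> \<alpha> j \<and> \<alpha> j \<le> \<rho>"
        unfolding \<alpha>_def \<rho>_def using l coef by (intro conjI sum_nonneg sum_mono mult_left_mono) auto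
    next
      show "0 \<le> \<rho>" unfolding \<rho>_def using l r0 by (intro sum_nonneg) auto
    next
      show "doubled x \<in> carrier_vec n" by (rule doubled_carrier)
    next
      have "2 * \<rho> = (\<Sum>i<m. l i * (2 * r i))" by (simp add: \<rho>_def sum_distrib_left mult.left_commute)
      also have "\<dots> \<le> (\<Sum>i<m. l i * (\<Sum>j<n. coef i j * doubled x $ j))"
      proof (intro sum_mono mult_left_mono)
        fix i assume i: "i \<in> {..<m}"
        \<comment> \<open>\<open>coef\<close> vanishes on saturated coordinates and all others are
          exactly doubled, so each cover inequality gains the full factor \<open>2\<close>.\<close>
        have "(\<Sum>j<n. coef i j * doubled x $ j) = (\<Sum>j<n. 2 * (coef i j * x $ j))"
          by (intro sum.cong) (auto simp: coef_def doubled_nth)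
        then show "2 * r i \<le> (\<Sum>j<n. coef i j * doubled x $ j)"
          using cover[of i] i by (simp flip: sum_distrib_left)
      qed (use l in auto)
      finally show "2 * \<rho> \<le> (\<Sum>j<n. \<alpha> j * doubled x $ j)" unfolding \<alpha>_sum .
    qed
    moreover have "box_knapsack n \<alpha> \<rho> (doubled x) \<subseteq> aggregated_points m n A b u l"
    proof
      fix z assume "z \<in> box_knapsack n \<alpha> \<rho> (doubled x)"
      then have zc: "z \<in> carrier_vec n" and z\<rho>: "\<rho> \<le> (\<Sum>j<n. \<alpha> j * z $ j)"
        and z: "\<And>j. j < n \<Longrightarrow> z $ j \<in> \<int>" "\<And>j. j < n \<Longrightarrow> of_int \<lfloor>doubled x $ j\<rfloor> \<le> z $ j"
          "\<And>j. j < n \<Longrightarrow> z $ j \<le> of_int \<lceil>doubled x $ j\<rceil>"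
        by (auto simp: box_knapsack_def)
      have z0: "0 \<le> z $ j" if "j < n" for j
        using z(2)[OF that] doubled_nonneg[OF that x0[OF that]] by (meson of_int_0_le_iff order_trans zero_le_floor)
      \<comment> \<open>A saturated coordinate sits at an integer, where floor and ceiling pin the
        rounded value.\<close>
      have zT: "z $ j = bound j" if "j < n" "j \<in> ?T" for j
        using z(2,3)[OF that(1)] that by (simp add: doubled_nth bound_def)
      \<comment> \<open>Finite bounds are integers, so rounding up cannot exceed them.\<close>
      have zu: "below_bounds z u"
        unfolding below_bounds_bound
      proof (intro allI impI)
        fix j assume j: "j < n" "u $ j \<noteq> \<infinity>"
        then have "doubled x $ j \<le> of_int (int (the_enat (u $ j)))"
          using doubled_below[of x] by (simp add: below_bounds_bound bound_def)
        then have "real_of_int \<lceil>doubled x $ j\<rceil> \<le> bound j"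
          unfolding bound_def by (metis ceiling_le_iff of_int_le_iff of_int_of_nat_eq)
        then show "z $ j \<le> bound j" using z(3)[OF j(1)] by linarith
      qed
      have row: "b $ i - r i + (\<Sum>j<n. coef i j * z $ j) \<le> (\<Sum>j<n. A $$ (i, j) * z $ j)" if i: "i < m" for i
      proof -
        \<comment> \<open>Either \<open>r i\<close> is the true remainder, or it was cut off at
          \<open>0\<close> because the fixed part already covers the row.\<close>
        have "b $ i - r i \<le> fixed i" by (simp add: r_def)
        moreover have "fixed i + (\<Sum>j<n. coef i j * z $ j) \<le> (\<Sum>j<n. A $$ (i, j) * z $ j)"
          unfolding fixed_def sum.distrib[symmetric]
        proof (rule sum_mono)
          fix j assume "j \<in> {..<n}"
          then show "(if j \<in> ?T then A $$ (i, j) * bound j else 0) + coef i j * z $ j \<le> A $$ (i, j) * z $ j"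
            using zT[of j] mult_right_mono[OF coef(3)[OF i] z0, of j j] by (auto simp: coef_def)
        qed
        ultimately show ?thesis by linarith
      qed
      have "(\<Sum>i<m. l i * b $ i) \<le> (\<Sum>i<m. l i * b $ i) - \<rho> + (\<Sum>j<n. \<alpha> j * z $ j)"
        using z\<rho> by simp
      also have "\<dots> = (\<Sum>i<m. l i * (b $ i - r i + (\<Sum>j<n. coef i j * z $ j)))"
        unfolding \<alpha>_sum \<rho>_def by (simp add: algebra_simps sum.distrib sum_subtractf)
      also have "\<dots> \<le> (\<Sum>i<m. l i * (\<Sum>j<n. A $$ (i, j) * z $ j))"
        using row l by (intro sum_mono mult_left_mono) auto
      finally show "z \<in> aggregated_points m n A b u l"
        using zc z(1) z0 zu by (simp add: aggregated_points_def Nats_altdef2)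
    qed
    ultimately show ?thesis using conv_hull_mono by blast
  qed
  then show ?thesis unfolding mem_aggregation[OF A b] by blast
qed

text \<open>If no feasible point vanishes on \<open>K\<close>, then already a single row forces a positive lower
  bound on the sum over \<open>K\<close>, which the Chvatal-Gomory closure of that row rounds up to \<open>1\<close>.
  A large value \<open>B\<close> stands for the missing bounds outside \<open>K\<close>; rows with \<open>A\<^sub>i\<^sub>j = 0\<close> contribute
  \<open>b\<^sub>i / 0 = 0\<close> to it.\<close>

lemma covered_support:
  assumes x: "x \<in> one_row chvatal_gomory A b u"
    and K: "\<And>q. q \<in> covering_polyhedron A b u \<Longrightarrow> \<exists>j<n. j \<in> K \<and> q $ j \<noteq> 0"
  shows "1 \<le> (\<Sum>j<n. if j \<in> K then x $ j else 0)"
proof -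
  define B where "B = (\<Sum>i<m. \<Sum>j<n. b $ i / A $$ (i, j))"
  have quot: "0 \<le> b $ i / A $$ (i, j)" if "i < m" "j < n" for i j
    using that A_nonneg b_nonneg by simp
  have B: "b $ i / A $$ (i, j) \<le> B" if ij: "i < m" "j < n" for i j
  proof -
    have "b $ i / A $$ (i, j) \<le> (\<Sum>j<n. b $ i / A $$ (i, j))"
      by (rule member_le_sum) (use ij quot in auto)
    also have "\<dots> \<le> B"
      unfolding B_def by (rule member_le_sum[of i _ "\<lambda>i. \<Sum>j<n. b $ i / A $$ (i, j)"])
        (use ij quot in \<open>auto intro: sum_nonneg\<close>)
    finally show ?thesis .
  qed
  have "0 \<le> B" unfolding B_def using quot by (intro sum_nonneg) auto
  \<comment> \<open>\<open>q\<close> vanishes on \<open>K\<close> and is therefore infeasible; since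
    its signs and bounds are fine, some single row must fail.\<close>
  define q where "q = vec n (\<lambda>j. if j \<in> K then 0 else if u $ j = \<infinity> then B else bound j)"
  have q: "q $ j = (if j \<in> K then 0 else if u $ j = \<infinity> then B else bound j)" if "j < n" for j
    using that by (simp add: q_def)
  have q0: "0 \<le> q $ j" if "j < n" for j
    using that \<open>0 \<le> B\<close> bound_nonneg by (simp add: q)
  have "below_bounds q u"
    using bound_nonneg by (auto simp: below_bounds_bound q)
  moreover have "q \<notin> covering_polyhedron A b u"
    using K[of q] q by auto
  moreover have "q \<in> carrier_vec n" by (simp add: q_def)
  ultimately obtain i where i: "i < m" and iq: "(\<Sum>j<n. A $$ (i, j) * q $ j) < b $ i"
    using q0 by (auto simp: mem_covering_polyhedron[OF A b] not_le)
  \<comment> \<open>Otherwise the value \<open>B\<close> at this coordinate alone would satisfy row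
    \<open>i\<close>.\<close>
  have zero: "A $$ (i, j) = 0" if j: "j < n" "j \<notin> K" "u $ j = \<infinity>" for j
  proof (rule ccontr)
    assume "A $$ (i, j) \<noteq> 0"
    then have pos: "0 < A $$ (i, j)" using A_nonneg[OF i j(1)] by simp
    then have "b $ i \<le> A $$ (i, j) * B" using B[OF i j(1)] by (simp add: field_simps)
    also have "A $$ (i, j) * B = A $$ (i, j) * q $ j" using j by (simp add: q)
    also have "\<dots> \<le> (\<Sum>j<n. A $$ (i, j) * q $ j)"
      by (rule member_le_sum) (use j q0 A_nonneg[OF i] in auto)
    finally show False using iq by simp
  qed
  \<comment> \<open>The shortfall \<open>\<delta>\<close> of \<open>q\<close> has to come from
    \<open>K\<close>, where every coefficient is at most \<open>D\<close>; the summand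
    \<open>1\<close> keeps \<open>D\<close> positive even for a zero row.\<close>
  define \<delta> where "\<delta> = b $ i - (\<Sum>j<n. A $$ (i, j) * q $ j)"
  define D where "D = 1 + (\<Sum>j<n. A $$ (i, j))"
  have "0 < \<delta>" using iq by (simp add: \<delta>_def)
  have A_le_D: "A $$ (i, j) \<le> D" if "j < n" for j
  proof -
    have "A $$ (i, j) \<le> (\<Sum>j<n. A $$ (i, j))"
      by (rule member_le_sum) (use that A_nonneg[OF i] in auto)
    then show ?thesis by (simp add: D_def)
  qed
  have "0 < D" unfolding D_def using sum_nonneg[of "{..<n}" "\<lambda>j. A $$ (i, j)"] A_nonneg[OF i] by simp
  have ind: "(\<Sum>j<n. (if j \<in> K then 1 else 0) * y $ j) = (\<Sum>j<n. if j \<in> K then y $ j else 0)"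
    for y :: "real vec" by (intro sum.cong) auto
  have valid: "\<delta> / D \<le> (\<Sum>j<n. (if j \<in> K then 1 else 0) * y $ j)"
    if "y \<in> covering_polyhedron (row_mat i) (row_rhs i) u" for y
  proof -
    have y: "\<And>j. j < n \<Longrightarrow> 0 \<le> y $ j" "b $ i \<le> (\<Sum>j<n. A $$ (i, j) * y $ j)"
      "\<And>j. j < n \<Longrightarrow> u $ j \<noteq> \<infinity> \<Longrightarrow> y $ j \<le> bound j"
      using that by (auto simp: mem_row_polyhedron[OF i] below_bounds_bound)
    have "\<delta> \<le> (\<Sum>j<n. A $$ (i, j) * y $ j - A $$ (i, j) * q $ j)"
      using y(2) by (simp add: \<delta>_def sum_subtractf)
    also have "\<dots> \<le> (\<Sum>j<n. D * (if j \<in> K then y $ j else 0))"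
    proof (rule sum_mono)
      fix j assume "j \<in> {..<n}"
      then have j: "j < n" by simp
      show "A $$ (i, j) * y $ j - A $$ (i, j) * q $ j \<le> D * (if j \<in> K then y $ j else 0)"
      proof (cases "j \<in> K")
        case True
        then show ?thesis using mult_right_mono[OF A_le_D[OF j] y(1)[OF j]] j by (simp add: q)
      next
        case False
        \<comment> \<open>Outside \<open>K\<close> no point of the row polyhedron contributes more
          than \<open>q\<close>: either the coefficient is zero or \<open>q\<close> is at the
          bound.\<close>
        then have "A $$ (i, j) * y $ j \<le> A $$ (i, j) * q $ j"
          using zero[OF j False] y(3)[OF j] A_nonneg[OF i j] j
          by (cases "u $ j = \<infinity>") (auto simp: q intro: mult_left_mono)
        then show ?thesis using False by simp
      qed
    qed
    also have "\<dots> = D * (\<Sum>j<n. if j \<in> K then y $ j else 0)" by (simp add: sum_distrib_left)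
    finally show ?thesis using \<open>0 < D\<close> unfolding ind by (simp add: field_simps)
  qed
  have "x \<in> chvatal_gomory (row_mat i) (row_rhs i) u"
    using x i by (simp add: mem_one_row)
  then have "of_int \<lceil>\<delta> / D\<rceil> \<le> (\<Sum>j<n. (if j \<in> K then 1 else 0) * x $ j)"
    using valid unfolding mem_chvatal_gomory[OF row_data(1)]
    by (elim conjE allE[of _ "\<lambda>j. if j \<in> K then 1 else 0"] allE[of _ "\<delta> / D"]) auto
  \<comment> \<open>Any positive right-hand side, however small, rounds up to at least
    \<open>1\<close>.\<close>
  moreover have "1 \<le> \<lceil>\<delta> / D\<rceil>" using \<open>0 < \<delta>\<close> \<open>0 < D\<close> by simp
  then have "1 \<le> real_of_int \<lceil>\<delta> / D\<rceil>" by linarith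
  ultimately show ?thesis unfolding ind by linarith
qed

text \<open>The coordinates with negative coefficient in a Chvatal-Gomory cut are fixed at their bounds
  together with the saturated ones. The residual cut has non-negative coefficients, so doubling
  gains enough to round up its right-hand side unless that side lies strictly between \<open>0\<close> and \<open>1\<close>.\<close>

lemma doubled_in_chvatal_gomory:
  assumes x: "x \<in> one_row chvatal_gomory A b u"
  shows "doubled x \<in> chvatal_gomory A b u"
proof -
  let ?P = "covering_polyhedron A b u"
  have xi: "x \<in> covering_polyhedron (row_mat i) (row_rhs i) u" if "i < m" for i
    using x that by (simp add: mem_one_row mem_chvatal_gomory[OF row_data(1)])
  then have xP: "x \<in> ?P"
    using rows by (auto simp: mem_row_polyhedron mem_covering_polyhedron[OF A b])
  then have x0: "\<And>j. j < n \<Longrightarrow> 0 \<le> x $ j" and xc: "x \<in> carrier_vec n"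
    and xu: "\<And>j. j < n \<Longrightarrow> u $ j \<noteq> \<infinity> \<Longrightarrow> x $ j \<le> bound j"
    by (auto simp: mem_covering_polyhedron[OF A b] below_bounds_bound)
  \<comment> \<open>Non-negative coefficients allow a feasible point to be raised anywhere within
    its bounds.\<close>
  have larger: "z \<in> ?P"
    if "q \<in> ?P" "z \<in> carrier_vec n" "below_bounds z u" "\<And>j. j < n \<Longrightarrow> q $ j \<le> z $ j" for q z
  proof -
    have "(\<Sum>j<n. A $$ (i, j) * q $ j) \<le> (\<Sum>j<n. A $$ (i, j) * z $ j)" if "i < m" for i
      using A_nonneg[OF that] \<open>\<And>j. j < n \<Longrightarrow> q $ j \<le> z $ j\<close> by (intro sum_mono mult_left_mono) auto
    then show ?thesis
      using that unfolding mem_covering_polyhedron[OF A b] by (meson order_trans)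
  qed
  have yP: "doubled x \<in> ?P"
  proof (rule larger[OF xP doubled_carrier doubled_below])
    fix j assume "j < n"
    then show "x $ j \<le> doubled x $ j" using x0[of j] xu[of j] by (auto simp: doubled_nth saturated_def)
  qed
  have "of_int \<lceil>\<beta>\<rceil> \<le> (\<Sum>j<n. a j * doubled x $ j)"
    if a: "\<forall>j<n. a j \<in> \<int>" and \<beta>: "\<forall>y\<in>?P. \<beta> \<le> (\<Sum>j<n. a j * y $ j)" for a \<beta>
  proof -
    have neg_finite: "u $ j \<noteq> \<infinity>" if j: "j < n" "a j < 0" for j
    proof
      assume "u $ j = \<infinity>"
      \<comment> \<open>\<open>s\<close> is chosen to push the left-hand side down to
        \<open>\<beta> - 1\<close> while staying feasible, which contradicts validity.\<close>
      define s where "s = ((\<Sum>k<n. a k * x $ k) - \<beta> + 1) / (- a j)"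
      define q where "q = vec n (\<lambda>k. x $ k + (if k = j then s else 0))"
      have "\<beta> \<le> (\<Sum>k<n. a k * x $ k)" using \<beta> xP by blast
      then have "0 \<le> s" using j unfolding s_def by (intro divide_nonneg_pos) simp_all
      then have "q \<in> ?P" using xu \<open>u $ j = \<infinity>\<close>
        by (intro larger[OF xP]) (auto simp: q_def below_bounds_bound)
      then have "\<beta> \<le> (\<Sum>k<n. a k * q $ k)" using \<beta> by blast
      also have "\<dots> = (\<Sum>k<n. a k * x $ k) + (\<Sum>k<n. if k = j then a k * s else 0)"
        unfolding sum.distrib[symmetric] by (intro sum.cong) (auto simp: q_def algebra_simps)
      also have "\<dots> = \<beta> - 1" using j by (simp add: s_def)
      finally show False by simp
    qed
    define T where "T = saturated x \<union> {j. j < n \<and> a j < 0}"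
    have T_finite: "u $ j \<noteq> \<infinity>" if "j \<in> T" for j
      using that neg_finite by (auto simp: T_def saturated_def)
    define S where "S = (\<Sum>j<n. if j \<in> T then a j * bound j else 0)"
    define F where "F z = (\<Sum>j<n. if j \<in> T then 0 else a j * z $ j)" for z :: "real vec"
    have residual: "\<beta> \<le> S + F q" if "q \<in> ?P" for q
    proof -
      \<comment> \<open>Raising all of \<open>T\<close> to the bounds stays feasible, so validity at
        \<open>q'\<close> is the residual inequality for \<open>q\<close>.\<close>
      define q' where "q' = vec n (\<lambda>j. if j \<in> T then bound j else q $ j)"
      have "q' \<in> ?P"
        using that T_finite
        by (intro larger[OF that]) (auto simp: q'_def below_bounds_bound mem_covering_polyhedron[OF A b])
      then have "\<beta> \<le> (\<Sum>j<n. a j * q' $ j)" using \<beta> by blast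
      also have "\<dots> = S + F q"
        unfolding S_def F_def sum.distrib[symmetric] by (intro sum.cong) (auto simp: q'_def)
      finally show ?thesis .
    qed
    have "F x \<ge> 0"
      unfolding F_def using x0 by (intro sum_nonneg) (auto simp: T_def not_less)
    \<comment> \<open>An integral \<open>S\<close> passes through the ceiling, so only
      \<open>\<beta> - S\<close> has to be rounded.\<close>
    have "S \<in> \<int>"
      unfolding S_def using a by (intro Ints_sum) (auto simp: bound_def intro!: Ints_mult)
    then obtain k where k: "S = of_int k" by (auto elim: Ints_cases)
    have "S + 2 * F x \<le> (\<Sum>j<n. a j * doubled x $ j)"
      unfolding S_def F_def sum_distrib_left sum.distrib[symmetric]
    proof (rule sum_mono)
      fix j assume "j \<in> {..<n}"
      then have j: "j < n" by simp
      consider "j \<in> saturated x" | "a j < 0" "j \<in> T" | "j \<notin> T" using j by (auto simp: T_def)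
      then show "(if j \<in> T then a j * bound j else 0) + 2 * (if j \<in> T then 0 else a j * x $ j) \<le> a j * doubled x $ j"
      proof cases
        case 1
        then show ?thesis using j by (simp add: T_def doubled_nth)
      next
        case 2
        \<comment> \<open>With a negative coefficient, staying below the bound only raises the
          left-hand side.\<close>
        then have "doubled x $ j \<le> bound j"
          using doubled_below[of x] T_finite j by (simp add: below_bounds_bound)
        then show ?thesis using 2 by (simp add: mult_left_mono_neg)
      next
        case 3
        then show ?thesis using j by (simp add: T_def doubled_nth)
      qed
    qed
    moreover have "of_int \<lceil>\<beta> - S\<rceil> \<le> 2 * F x"
    proof -
      consider "\<beta> - S \<le> 0" | "1 \<le> \<beta> - S" | "0 < \<beta> - S" "\<beta> - S < 1" by linarith
      then show ?thesis
      proof cases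
        case 1
        then have "\<lceil>\<beta> - S\<rceil> \<le> 0" by (simp add: ceiling_le_iff)
        then show ?thesis using \<open>F x \<ge> 0\<close> by linarith
      next
        case 2
        \<comment> \<open>The ceiling is below \<open>\<beta> - S + 1\<close>, which here is at most
          \<open>2 * (\<beta> - S)\<close>.\<close>
        then show ?thesis using residual[OF xP] by linarith
      next
        case 3
        \<comment> \<open>\<open>K\<close> is the support of the residual cut. A feasible point
          vanishing there would make \<open>F\<close> zero, although it must be at least the
          positive \<open>\<beta> - S\<close>.\<close>
        define K where "K = {j. j \<notin> T \<and> 0 < a j}"
        have "1 \<le> (\<Sum>j<n. if j \<in> K then x $ j else 0)"
        proof (rule covered_support[OF x], rule ccontr)
          fix q assume q: "q \<in> ?P" "\<not> (\<exists>j<n. j \<in> K \<and> q $ j \<noteq> 0)"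
          have "F q = 0"
            unfolding F_def
          proof (intro sum.neutral ballI)
            fix j assume "j \<in> {..<n}"
            then have j: "j < n" by simp
            show "(if j \<in> T then 0 else a j * q $ j) = 0"
            proof (cases "j \<in> T \<or> j \<in> K")
              case True
              then show ?thesis using q(2) j by auto
            next
              case False
              then have "a j = 0" using j by (auto simp: K_def T_def)
              then show ?thesis by simp
            qed
          qed
          then show False using residual[OF q(1)] 3 by simp
        qed
        also have "\<dots> \<le> F x"
          unfolding F_def
        proof (rule sum_mono)
          fix j assume "j \<in> {..<n}"
          then have j: "j < n" by simp
          show "(if j \<in> K then x $ j else 0) \<le> (if j \<in> T then 0 else a j * x $ j)"
          proof (cases "j \<in> K")
            case True
            obtain i where "a j = of_int i" using a j by (auto elim: Ints_cases)
            then have "1 \<le> a j" using True by (simp add: K_def)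
            then show ?thesis
              using True mult_right_mono[OF _ x0[OF j], of 1 "a j"] by (simp add: K_def)
          next
            case False
            then show ?thesis using x0[OF j] j by (auto simp: K_def T_def not_less)
          qed
        qed
        finally show ?thesis using 3 by linarith
      qed
    qed
    moreover have "\<lceil>\<beta> - S\<rceil> = \<lceil>\<beta>\<rceil> - k" unfolding k by simp
    ultimately show ?thesis by (simp add: k)
  qed
  then show ?thesis using yP unfolding mem_chvatal_gomory[OF A] by blast
qed

end

section \<open>From pointwise domination to approximation\<close>

lemma approximation_ofI:
  assumes "0 < \<alpha>"
    and "\<And>x. x \<in> U \<Longrightarrow> \<exists>y\<in>V. \<forall>c\<in>carrier_vec n. 0\<^sub>v n \<le> c \<longrightarrow> c \<bullet> y \<le> \<alpha> * (c \<bullet> x)"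
  shows "approximation_of n \<alpha> U V"
  unfolding approximation_of_def
proof (intro conjI ballI impI INF_greatest)
  fix c x :: "real vec" assume c: "c \<in> carrier_vec n" "0\<^sub>v n \<le> c" and "x \<in> U"
  with assms(2) c obtain y where y: "y \<in> V" "c \<bullet> y \<le> \<alpha> * (c \<bullet> x)" by blast
  have "ereal (1 / \<alpha>) * (INF x\<in>V. ereal (c \<bullet> x)) \<le> ereal (1 / \<alpha>) * ereal (c \<bullet> y)"
    using \<open>0 < \<alpha>\<close> y(1) by (intro ereal_mult_left_mono INF_lower) simp_all
  also have "\<dots> \<le> ereal (c \<bullet> x)"
    using y(2) \<open>0 < \<alpha>\<close> by (simp add: field_simps)
  finally show "ereal (1 / \<alpha>) * (INF x\<in>V. ereal (c \<bullet> x)) \<le> ereal (c \<bullet> x)" .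
qed (fact assms(1))

text \<open>Every coordinate of \<open>doubled x\<close> is at most twice that of \<open>x\<close>,
  so the same point serves every non-negative objective.\<close>

lemma (in covering_system) one_row_2_approximation:
  assumes M: "M = aggregation \<or> M = chvatal_gomory"
  shows "approximation_of n 2 (one_row M A b u) (M A b u)"
proof (rule approximation_ofI)
  fix x assume x: "x \<in> one_row M A b u"
  have xc: "x \<in> carrier_vec n"
    using M x rows conv_hull_carrier[of x n "row_points 0"]
    by (auto simp: mem_one_row aggregation_row mem_chvatal_gomory[OF row_data(1)] mem_row_polyhedron)
  have "c \<bullet> doubled x \<le> 2 * (c \<bullet> x)" if c: "c \<in> carrier_vec n" "0\<^sub>v n \<le> c" for c
  proof -
    have "c \<bullet> doubled x = (\<Sum>j\<in>{0..<n}. c $ j * doubled x $ j)"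
      using doubled_carrier[of x] by (simp add: scalar_prod_def)
    also have "\<dots> \<le> (\<Sum>j\<in>{0..<n}. c $ j * (2 * x $ j))"
      using c doubled_le by (intro sum_mono mult_left_mono) (auto simp: less_eq_vec_def)
    also have "\<dots> = 2 * (c \<bullet> x)"
      using xc by (simp add: scalar_prod_def sum_distrib_left mult.left_commute)
    finally show ?thesis .
  qed
  moreover have "doubled x \<in> M A b u"
    using M x doubled_in_aggregation doubled_in_chvatal_gomory by auto
  ultimately show "\<exists>y\<in>M A b u. \<forall>c\<in>carrier_vec n. 0\<^sub>v n \<le> c \<longrightarrow> c \<bullet> y \<le> 2 * (c \<bullet> x)"
    by blast
qed simp

section \<open>Tightness\<close>

text \<open>The all-ones matrix minus the identity.\<close>

definition complement_mat :: "nat \<Rightarrow> real mat" where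
  "complement_mat n = mat n n (\<lambda>(i, j). if i = j then 0 else 1)"

lemma complement_mat_row:
  assumes "i < n"
  shows "(\<Sum>j<n. complement_mat n $$ (i, j) * z j) = (\<Sum>j<n. z j) - z i"
proof -
  have "(\<Sum>j<n. complement_mat n $$ (i, j) * z j) = (\<Sum>j<n. z j - (if j = i then z j else 0))"
    using assms by (intro sum.cong) (auto simp: complement_mat_def)
  then show ?thesis using assms by (simp add: sum_subtractf)
qed

text \<open>Each variable is missing from exactly one of the \<open>k + 1\<close> rows and is
  therefore counted \<open>k\<close> times.\<close>

lemma complement_mat_total:
  "(\<Sum>i<Suc k. (\<Sum>j<Suc k. complement_mat (Suc k) $$ (i, j) * z j)) = real k * (\<Sum>j<Suc k. z j)"
proof -
  have "(\<Sum>i<Suc k. (\<Sum>j<Suc k. complement_mat (Suc k) $$ (i, j) * z j)) = (\<Sum>i<Suc k. (\<Sum>j<Suc k. z j) - z i)"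
    by (intro sum.cong refl complement_mat_row) simp
  also have "\<dots> = real (Suc k) * (\<Sum>j<Suc k. z j) - (\<Sum>j<Suc k. z j)"
    unfolding sum_subtractf by simp
  finally show ?thesis by (simp add: algebra_simps)
qed

text \<open>Every \<open>k\<close> of the \<open>k + 1\<close> variables sum to at least \<open>1\<close>. The constant vector \<open>1/k\<close> satisfies
  every single row closure, while adding up all rows gives \<open>k \<Sum>\<^sub>j x\<^sub>j \<ge> k + 1\<close>, hence \<open>\<Sum>\<^sub>j x\<^sub>j \<ge> 2\<close>
  on integer points.\<close>

context
  fixes k :: nat and u :: "enat vec" and b :: "real vec"
  assumes k: "0 < k"
  defines "u \<equiv> vec (Suc k) (\<lambda>_. \<infinity>)" and "b \<equiv> vec (Suc k) (\<lambda>_. 1)"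
begin

lemma complement_covering_data: "covering_data (Suc k) (Suc k) (complement_mat (Suc k)) b u"
  by (auto simp: covering_data_def complement_mat_def u_def b_def)

interpretation covering_system "Suc k" "Suc k" "complement_mat (Suc k)" b u
  by unfold_locales (auto simp: complement_mat_def u_def b_def)

text \<open>For row \<open>i\<close> the constant vector is the average of \<open>k\<close> integer
  points, one for each coordinate other than \<open>i\<close>.\<close>

lemma complement_one_row:
  assumes M: "M = aggregation \<or> M = chvatal_gomory"
  shows "vec (Suc k) (\<lambda>_. 1 / real k) \<in> one_row M (complement_mat (Suc k)) b u"
proof -
  have "vec (Suc k) (\<lambda>_. 1 / real k) \<in> conv_hull (Suc k) (row_points i)" if i: "i < Suc k" for i
  proof -
    \<comment> \<open>Coordinate \<open>i\<close> must average to \<open>1 / k\<close> as well, so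
      the unit vector for \<open>s\<close> gets an extra \<open>1\<close> there, which
      \<open>g\<close> encodes. An index \<open>s \<noteq> i\<close> exists because \<open>k\<close>
      is positive.\<close>
    define s where "s = (if i = 0 then 1 else 0 :: nat)"
    have s: "s < Suc k" "s \<noteq> i" using k by (auto simp: s_def)
    define g where "g j = (if j = i then s else j)" for j
    define f where "f l = vec (Suc k) (\<lambda>j. if l = g j then 1 else 0 :: real)" for l
    define I where "I = {..<Suc k} - {i}"
    have I: "finite I" "card I = k" using i by (simp_all add: I_def)
    have "vec (Suc k) (\<lambda>j. \<Sum>l\<in>I. 1 / real k * f l $ j) \<in> conv_hull (Suc k) (row_points i)"
    proof (rule conv_hull_combination[OF I(1)])
      fix l assume "l \<in> I"
      then have l: "l < Suc k" "l \<noteq> i" by (auto simp: I_def)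
      have "1 = f l $ l" using l by (simp add: f_def g_def)
      also have "\<dots> \<le> (\<Sum>j\<in>{..<Suc k} - {i}. f l $ j)"
        by (rule member_le_sum) (use l in \<open>auto simp: f_def\<close>)
      also have "\<dots> = (\<Sum>j<Suc k. f l $ j) - f l $ i"
        using i by (subst sum_diff1) auto
      finally show "f l \<in> row_points i"
        unfolding row_points_def complement_mat_row[OF i] using i
        by (auto simp: f_def b_def u_def below_bounds_def)
    qed (use I k in simp_all)
    moreover have "(\<Sum>l\<in>I. 1 / real k * f l $ j) = 1 / real k" if j: "j < Suc k" for j
    proof -
      have "g j \<in> I" using s j by (auto simp: g_def I_def)
      have "(\<Sum>l\<in>I. 1 / real k * f l $ j) = (\<Sum>l\<in>I. if l = g j then 1 / real k else 0)"
        using j by (intro sum.cong) (auto simp: f_def)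
      then show ?thesis using I(1) \<open>g j \<in> I\<close> by simp
    qed
    then have "vec (Suc k) (\<lambda>j. \<Sum>l\<in>I. 1 / real k * f l $ j) = vec (Suc k) (\<lambda>_. 1 / real k)"
      by (intro eq_vecI) simp_all
    ultimately show ?thesis by simp
  qed
  then show ?thesis
    using M row_hull_in_chvatal_gomory by (auto simp: mem_one_row aggregation_row)
qed

text \<open>The sum of all rows, divided by \<open>k\<close>, has right-hand side
  \<open>(k + 1) / k\<close>. For aggregation, integrality of the points rounds it up; for
  Chvatal-Gomory, the cut with all coefficients \<open>1\<close> does.\<close>

lemma complement_closure_sum:
  assumes M: "M = aggregation \<or> M = chvatal_gomory" and y: "y \<in> M (complement_mat (Suc k)) b u"
  shows "y \<in> carrier_vec (Suc k)" "2 \<le> (\<Sum>j<Suc k. y $ j)"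
proof -
  have total: "real (Suc k) / real k \<le> (\<Sum>j<Suc k. z j)"
    if "real (Suc k) \<le> (\<Sum>i<Suc k. \<Sum>j<Suc k. complement_mat (Suc k) $$ (i, j) * z j)" for z
    using that k unfolding complement_mat_total by (simp only: pos_divide_le_eq of_nat_0_less_iff mult.commute)
  \<comment> \<open>The quotient exceeds \<open>1\<close> and is at most \<open>2\<close>, with
    equality for \<open>k = 1\<close>.\<close>
  have ceil: "\<lceil>real (Suc k) / real k\<rceil> = 2"
    using k by (intro ceiling_unique) (auto simp: field_simps)
  have "y \<in> carrier_vec (Suc k) \<and> 2 \<le> (\<Sum>j<Suc k. 1 * y $ j)"
    using M
  proof
    assume "M = aggregation"
    then have hull: "y \<in> conv_hull (Suc k) (aggregated_points (Suc k) (Suc k) (complement_mat (Suc k)) b u (\<lambda>_. 1))"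
      using y by (simp add: mem_aggregation[OF A b] del: sum.lessThan_Suc)
    have "2 \<le> (\<Sum>j<Suc k. 1 * z $ j)"
      if z: "z \<in> aggregated_points (Suc k) (Suc k) (complement_mat (Suc k)) b u (\<lambda>_. 1)" for z
    proof -
      have "real (Suc k) / real k \<le> (\<Sum>j<Suc k. z $ j)"
        using z by (intro total) (simp add: aggregated_points_def b_def del: sum.lessThan_Suc)
      moreover have "(\<Sum>j<Suc k. z $ j) \<in> \<int>"
        using z by (intro Ints_sum) (auto simp: aggregated_points_def Nats_altdef2)
      ultimately have "\<lceil>real (Suc k) / real k\<rceil> \<le> (\<Sum>j<Suc k. z $ j)"
        by (auto elim!: Ints_cases simp: ceiling_le_iff simp del: sum.lessThan_Suc)
      then show ?thesis unfolding ceil by simp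
    qed
    then show ?thesis by (intro conjI conv_hull_carrier[OF hull] conv_hull_linear_ge[OF hull])
  next
    assume "M = chvatal_gomory"
    then have cg: "y \<in> chvatal_gomory (complement_mat (Suc k)) b u" using y by simp
    have valid: "real (Suc k) / real k \<le> (\<Sum>j<Suc k. 1 * z $ j)"
      if z: "z \<in> covering_polyhedron (complement_mat (Suc k)) b u" for z
    proof -
      have "(\<Sum>i<Suc k. 1) \<le> (\<Sum>i<Suc k. \<Sum>j<Suc k. complement_mat (Suc k) $$ (i, j) * z $ j)"
        using z unfolding mem_covering_polyhedron[OF A b] by (intro sum_mono) (auto simp: b_def)
      then show ?thesis using total[of "($) z"] by (simp del: sum.lessThan_Suc)
    qed
    have "of_int \<lceil>real (Suc k) / real k\<rceil> \<le> (\<Sum>j<Suc k. 1 * y $ j)"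
      using cg valid unfolding mem_chvatal_gomory[OF A]
      by (elim conjE allE[of _ "\<lambda>_. 1"] allE[of _ "real (Suc k) / real k"]) auto
    moreover have "y \<in> carrier_vec (Suc k)"
      using cg unfolding mem_chvatal_gomory[OF A] mem_covering_polyhedron[OF A b] by blast
    ultimately show ?thesis unfolding ceil by simp
  qed
  then show "y \<in> carrier_vec (Suc k)" "2 \<le> (\<Sum>j<Suc k. y $ j)" by simp_all
qed

text \<open>For the all-ones objective the two infima have ratio at least
  \<open>2 k / (k + 1) = 2 - 2 / (k + 1)\<close>, which exceeds \<open>2 - \<epsilon>\<close> by the
  choice of \<open>k\<close>.\<close>

lemma complement_not_approximation:
  assumes M: "M = aggregation \<or> M = chvatal_gomory" and \<epsilon>: "2 < \<epsilon> * real (Suc k)"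
  shows "\<not> approximation_of (Suc k) (2 - \<epsilon>)
    (one_row M (complement_mat (Suc k)) b u) (M (complement_mat (Suc k)) b u)"
proof
  let ?V = "M (complement_mat (Suc k)) b u" and ?U = "one_row M (complement_mat (Suc k)) b u"
  assume approx: "approximation_of (Suc k) (2 - \<epsilon>) ?U ?V"
  define c where "c = vec (Suc k) (\<lambda>_. 1 :: real)"
  have sp: "c \<bullet> y = (\<Sum>j<Suc k. y $ j)" if "y \<in> carrier_vec (Suc k)" for y
    using that by (auto simp: c_def scalar_prod_def lessThan_atLeast0 intro!: sum.cong)
  \<comment> \<open>The notion includes a positive factor, which disposes of
    \<open>\<epsilon> \<ge> 2\<close> and lets the infima be scaled.\<close>
  have \<alpha>: "0 < 2 - \<epsilon>" using approx by (simp add: approximation_of_def)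
  have "ereal 2 \<le> (INF y\<in>?V. ereal (c \<bullet> y))"
    using complement_closure_sum[OF M] by (intro INF_greatest) (simp add: sp del: sum.lessThan_Suc)
  then have "ereal (1 / (2 - \<epsilon>)) * ereal 2 \<le> ereal (1 / (2 - \<epsilon>)) * (INF y\<in>?V. ereal (c \<bullet> y))"
    using \<alpha> by (intro ereal_mult_left_mono) simp_all
  also have "\<dots> \<le> (INF x\<in>?U. ereal (c \<bullet> x))"
    using approx by (auto simp: approximation_of_def c_def less_eq_vec_def)
  also have "\<dots> \<le> ereal (c \<bullet> vec (Suc k) (\<lambda>_. 1 / real k))"
    by (rule INF_lower[OF complement_one_row[OF M]])
  also have "c \<bullet> vec (Suc k) (\<lambda>_. 1 / real k) = real (Suc k) / real k"
    by (subst sp) (simp_all add: add_divide_distrib)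
  finally have "2 / (2 - \<epsilon>) \<le> real (Suc k) / real k" by simp
  then have "2 * real k \<le> (2 - \<epsilon>) * real (Suc k)" using \<alpha> k by (simp add: field_simps)
  then show False using \<epsilon> by (simp add: algebra_simps)
qed

end

theorem theorem4:
  assumes "M = aggregation \<or> M = chvatal_gomory"
  shows "(\<forall>m n A b u. covering_data m n A b u \<longrightarrow>
            M A b u \<subseteq> one_row M A b u \<and>
            approximation_of n 2 (one_row M A b u) (M A b u)) \<and>
         (\<forall>\<epsilon>::real. \<epsilon> > 0 \<longrightarrow>
            (\<exists>m n A b u. covering_data m n A b u \<and>
               \<not> approximation_of n (2 - \<epsilon>) (one_row M A b u) (M A b u)))"
proof (intro conjI allI impI)
  fix m n A b u assume "covering_data m n A b u"
  then interpret covering_system m n A b u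
    by unfold_locales (auto simp: covering_data_def)
  show "M A b u \<subseteq> one_row M A b u"
    using assms one_row_aggregation_superset one_row_chvatal_gomory_superset by auto
  show "approximation_of n 2 (one_row M A b u) (M A b u)"
    using assms by (rule one_row_2_approximation)
next
  fix \<epsilon> :: real assume \<epsilon>: "\<epsilon> > 0"
  \<comment> \<open>The example needs \<open>k\<close> positive and
    \<open>2 < \<epsilon> * (k + 1)\<close>; any natural number above \<open>2 / \<epsilon>\<close>
    gives both.\<close>
  obtain k :: nat where k: "2 / \<epsilon> < real k" using reals_Archimedean2 by blast
  with \<epsilon> have "0 < real k" by (meson divide_pos_pos less_trans zero_less_numeral)
  then have k0: "0 < k" by simp
  have "2 < \<epsilon> * real k" using k \<epsilon> by (simp add: field_simps)
  then have "2 < \<epsilon> * real (Suc k)" using \<epsilon> by (simp add: algebra_simps)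
  then show "\<exists>m n A b u. covering_data m n A b u \<and>
      \<not> approximation_of n (2 - \<epsilon>) (one_row M A b u) (M A b u)"
    using complement_covering_data[OF k0] complement_not_approximation[OF k0 assms] by blast
qed

end
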